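(* Let $G$ be a finite group and let $T^G$ be the rooted tree defined below. Suppose $(g_1,\dots,g_n)\in G^{(n)}$ lies in the $G$-orbit $X\in T^G_n$, and let $S=Z_G(g_1,\dots,g_n)=Z_G(g_1)\cap\dots\cap Z_G(g_n)$ (intersection of centralizers). Then the full subtree $T^G(X)$ of $T^G$ consisting of the descendants of $X$, rooted at $X$, is isomorphic as a rooted tree to $T^S$.
   Context: For a finite group $H$ and $n\ge0$, let $H^{(n)}=\{(h_1,\dots,h_n)\in H^n: h_ih_j=h_jh_i\ \forall i,j\}$, and let $T^H_n$ be the set of orbits of $H$ acting on $H^{(n)}$ by simultaneous conjugation. The rooted tree $T^H$ has vertex set $\coprod_{n\ge0}T^H_n$, root the unique element of $T^H_0$, and $Y\in T^H_{n+1}$ is joined by an edge to (is a child of) $X\in T^H_n$ if there exists $(h_1,\dots,h_{n+1})\in Y$ with $(h_1,\dots,h_n)\in X$. A descendant of $X$ is any vertex reachable from $X$ by a (possibly empty) chain of child relations. *)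

theory Defs
  imports "HOL-Algebra.Group_Action" "Graph_Theory.Digraph_Isomorphism"
begin

section \<open>The rooted tree of commuting tuples\<close>

text \<open>Tuples are lists. As lists of different lengths are distinct, orbits for different
  \<open>n\<close> are distinct sets, so the coproduct over \<open>n\<close> of the sets of orbits is a plain union.\<close>

definition commuting_tuples :: "('a, 'b) monoid_scheme \<Rightarrow> nat \<Rightarrow> 'a list set" where
  "commuting_tuples H n =
     {hs. length hs = n \<and> set hs \<subseteq> carrier H \<and>
          (\<forall>x\<in>set hs. \<forall>y\<in>set hs. x \<otimes>\<^bsub>H\<^esub> y = y \<otimes>\<^bsub>H\<^esub> x)}"

definition conj_tuple :: "('a, 'b) monoid_scheme \<Rightarrow> 'a \<Rightarrow> 'a list \<Rightarrow> 'a list" where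
  "conj_tuple H k hs = map (\<lambda>h. k \<otimes>\<^bsub>H\<^esub> h \<otimes>\<^bsub>H\<^esub> inv\<^bsub>H\<^esub> k) hs"

definition tuple_orbits :: "('a, 'b) monoid_scheme \<Rightarrow> nat \<Rightarrow> 'a list set set" where
  "tuple_orbits H n = orbits H (commuting_tuples H n) (conj_tuple H)"

text \<open>Edges are oriented away from the root: an arc \<open>(X, Y)\<close> says that \<open>Y\<close> is a child of \<open>X\<close>.\<close>

definition tuple_tree ::
    "('a, 'b) monoid_scheme \<Rightarrow> ('a list set, 'a list set \<times> 'a list set) pre_digraph" where
  "tuple_tree H = with_proj
     \<lparr> pverts = (\<Union>n. tuple_orbits H n),
       parcs = {(X, Y). \<exists>n. X \<in> tuple_orbits H n \<and> Y \<in> tuple_orbits H (Suc n) \<and>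
                            (\<exists>hs h. hs @ [h] \<in> Y \<and> hs \<in> X)} \<rparr>"

definition tuple_tree_root :: "('a, 'b) monoid_scheme \<Rightarrow> 'a list set" where
  "tuple_tree_root H = the_elem (tuple_orbits H 0)"

lemma tuple_orbits_0:
  assumes "group H"
  shows "tuple_orbits H 0 = {{[]}}"
proof -
  have "commuting_tuples H 0 = {[]}"
    by (auto simp: commuting_tuples_def)
  moreover have "carrier H \<noteq> {}"
    using assms by (auto intro: group.is_monoid monoid.one_closed)
  ultimately show ?thesis
    by (auto simp: tuple_orbits_def orbits_def orbit_def conj_tuple_def)
qed

lemma tuple_tree_root_eq: "group H \<Longrightarrow> tuple_tree_root H = {[]}"
  by (simp add: tuple_tree_root_def tuple_orbits_0)

definition descendant_tree :: "('v, 'e) pre_digraph \<Rightarrow> 'v \<Rightarrow> ('v, 'e) pre_digraph" where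
  "descendant_tree T v = T \<restriction> {w. v \<rightarrow>\<^sup>*\<^bsub>T\<^esub> w}"

definition rooted_digraph_iso ::
    "('v, 'e) pre_digraph \<Rightarrow> 'v \<Rightarrow> ('w, 'f) pre_digraph \<Rightarrow> 'w \<Rightarrow> bool" where
  "rooted_digraph_iso T r T' r' \<longleftrightarrow>
     (\<exists>f. pre_digraph.digraph_isomorphism T f \<and> T' = app_iso f T \<and> iso_verts f r = r')"

section \<open>Centralizers\<close>

definition centralizer :: "('a, 'b) monoid_scheme \<Rightarrow> 'a \<Rightarrow> 'a set" where
  "centralizer G g = {h \<in> carrier G. h \<otimes>\<^bsub>G\<^esub> g = g \<otimes>\<^bsub>G\<^esub> h}"

text \<open>Intersecting with the carrier makes the centralizer of the empty tuple the whole group.\<close>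

definition tuple_centralizer :: "('a, 'b) monoid_scheme \<Rightarrow> 'a list \<Rightarrow> 'a set" where
  "tuple_centralizer G gs = carrier G \<inter> (\<Inter>g\<in>set gs. centralizer G g)"

end

theory Submission
  imports Defs
begin

text \<open>Let \<open>X\<close> be the orbit of \<open>gs\<close>, with centralizer \<open>S\<close>. The descendants of \<open>X\<close> are exactly the
  orbits containing a tuple of the form \<open>gs @ hs\<close>, and \<open>gs @ hs\<close> is a commuting tuple of \<open>G\<close> iff
  \<open>hs\<close> is a commuting tuple of \<open>S\<close>. An element conjugating \<open>gs @ hs\<close> to \<open>gs @ hs'\<close> fixes \<open>gs\<close>,
  hence lies in \<open>S\<close>. So \<open>Y \<mapsto> {hs. gs @ hs \<in> Y}\<close> sends descendants of \<open>X\<close> bijectively to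
  \<open>S\<close>-orbits of commuting tuples of \<open>S\<close>, and it preserves and reflects the child relation.\<close>

section \<open>Simultaneous conjugation\<close>

lemma conj_tuple_append [simp]:
  "conj_tuple H k (hs @ hs') = conj_tuple H k hs @ conj_tuple H k hs'"
  by (simp add: conj_tuple_def)

lemma length_conj_tuple [simp]: "length (conj_tuple H k hs) = length hs"
  by (simp add: conj_tuple_def)

lemma commuting_tuples_appendD1:
  "hs @ hs' \<in> commuting_tuples H m \<Longrightarrow> hs \<in> commuting_tuples H (length hs)"
  by (auto simp: commuting_tuples_def)

lemma commuting_tuples_length: "hs \<in> commuting_tuples H m \<Longrightarrow> length hs = m"
  by (simp add: commuting_tuples_def)

context group
begin

text \<open>Multiplicativity is what makes conjugated entries commute again when the original ones
  do.\<close>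

lemma conj_mult:
  assumes "k \<in> carrier G" "x \<in> carrier G" "y \<in> carrier G"
  shows "(k \<otimes> x \<otimes> inv k) \<otimes> (k \<otimes> y \<otimes> inv k) = k \<otimes> (x \<otimes> y) \<otimes> inv k"
proof -
  have "(k \<otimes> x \<otimes> inv k) \<otimes> (k \<otimes> y \<otimes> inv k) = k \<otimes> x \<otimes> ((inv k \<otimes> k) \<otimes> y) \<otimes> inv k"
    using assms by (simp only: m_assoc m_closed inv_closed)
  also have "\<dots> = k \<otimes> (x \<otimes> y) \<otimes> inv k"
    using assms by (simp add: m_assoc)
  finally show ?thesis .
qed

lemma conj_tuple_in_commuting_tuples:
  assumes "hs \<in> commuting_tuples G n" "k \<in> carrier G"
  shows "conj_tuple G k hs \<in> commuting_tuples G n"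
  using assms by (auto simp: commuting_tuples_def conj_tuple_def conj_mult subset_iff)

lemma conj_tuple_conj_tuple:
  assumes "set hs \<subseteq> carrier G" "k \<in> carrier G" "l \<in> carrier G"
  shows "conj_tuple G k (conj_tuple G l hs) = conj_tuple G (k \<otimes> l) hs"
  using assms by (auto simp: conj_tuple_def inv_mult_group m_assoc subset_iff)

lemma conj_tuple_one: "set hs \<subseteq> carrier G \<Longrightarrow> conj_tuple G \<one> hs = hs"
  by (auto simp: conj_tuple_def subset_iff intro: map_idI)

lemma in_orbit_self:
  assumes "set hs \<subseteq> carrier G"
  shows "hs \<in> orbit G (conj_tuple G) hs"
  using conj_tuple_one[OF assms] unfolding orbit_def by force

lemma orbit_conj_tuple:
  assumes "set hs \<subseteq> carrier G" "k \<in> carrier G"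
  shows "orbit G (conj_tuple G) (conj_tuple G k hs) = orbit G (conj_tuple G) hs"
proof -
  \<comment> \<open>Reindexing the conjugating element by \<open>l \<otimes> inv k\<close> gives one
    inclusion of orbits, by \<open>l \<otimes> k\<close> the other.\<close>
  have "conj_tuple G l hs = conj_tuple G (l \<otimes> inv k) (conj_tuple G k hs)"
    if "l \<in> carrier G" for l
    using that assms by (simp add: conj_tuple_conj_tuple m_assoc)
  moreover have "conj_tuple G l (conj_tuple G k hs) = conj_tuple G (l \<otimes> k) hs"
    if "l \<in> carrier G" for l
    using that assms by (simp add: conj_tuple_conj_tuple)
  ultimately show ?thesis
    using assms(2) unfolding orbit_def by (blast intro: m_closed inv_closed)
qed

section \<open>Vertices and their representatives\<close>

lemma tuple_orbits_memD:
  assumes "X \<in> tuple_orbits G n" "hs \<in> X"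
  shows "hs \<in> commuting_tuples G n" "X = orbit G (conj_tuple G) hs"
proof -
  obtain ks where ks: "ks \<in> commuting_tuples G n" "X = orbit G (conj_tuple G) ks"
    using assms by (auto simp: tuple_orbits_def orbits_def)
  then obtain k where k: "k \<in> carrier G" "hs = conj_tuple G k ks"
    using assms by (auto simp: orbit_def)
  show "hs \<in> commuting_tuples G n"
    using ks k conj_tuple_in_commuting_tuples by simp
  have "set ks \<subseteq> carrier G"
    using ks by (simp add: commuting_tuples_def)
  then show "X = orbit G (conj_tuple G) hs"
    using ks k by (simp add: orbit_conj_tuple)
qed

lemma orbit_in_tuple_orbits:
  "hs \<in> commuting_tuples G n \<Longrightarrow> orbit G (conj_tuple G) hs \<in> tuple_orbits G n"
  by (auto simp: tuple_orbits_def orbits_def)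

lemma in_orbit_self_commuting:
  "hs \<in> commuting_tuples G n \<Longrightarrow> hs \<in> orbit G (conj_tuple G) hs"
  by (simp add: commuting_tuples_def in_orbit_self)

lemma verts_tuple_treeE:
  assumes "X \<in> verts (tuple_tree G)"
  obtains hs where "hs \<in> X" "hs \<in> commuting_tuples G (length hs)"
proof -
  obtain n where n: "X \<in> tuple_orbits G n"
    using assms by (auto simp: tuple_tree_def)
  then obtain hs where "hs \<in> commuting_tuples G n" "X = orbit G (conj_tuple G) hs"
    by (auto simp: tuple_orbits_def orbits_def)
  then show thesis
    using that in_orbit_self_commuting commuting_tuples_length by metis
qed

text \<open>Any member may serve as representative, and its length is the level of the vertex, so no
  level index has to be carried along.\<close>

lemma verts_tuple_tree_memD:
  assumes "X \<in> verts (tuple_tree G)" "hs \<in> X"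
  shows "hs \<in> commuting_tuples G (length hs)" "X = orbit G (conj_tuple G) hs"
proof -
  obtain n where n: "X \<in> tuple_orbits G n"
    using assms(1) by (auto simp: tuple_tree_def)
  show "hs \<in> commuting_tuples G (length hs)" "X = orbit G (conj_tuple G) hs"
    using tuple_orbits_memD[OF n assms(2)] commuting_tuples_length by auto
qed

lemma orbit_in_verts_tuple_tree:
  "hs \<in> commuting_tuples G n \<Longrightarrow> orbit G (conj_tuple G) hs \<in> verts (tuple_tree G)"
  using orbit_in_tuple_orbits by (auto simp: tuple_tree_def)

section \<open>Arcs and descendants\<close>

lemma arcs_tuple_tree_iff:
  "(X, Y) \<in> arcs (tuple_tree G) \<longleftrightarrow>
     X \<in> verts (tuple_tree G) \<and> Y \<in> verts (tuple_tree G) \<and> (\<exists>hs h. hs @ [h] \<in> Y \<and> hs \<in> X)"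
proof -
  \<comment> \<open>All members of an orbit share one length, so the two tuples fix the levels of
    their orbits.\<close>
  have "n = Suc m"
    if "X \<in> tuple_orbits G m" "Y \<in> tuple_orbits G n" "hs @ [h] \<in> Y" "hs \<in> X" for m n hs h
    using tuple_orbits_memD(1)[OF that(1,4)] tuple_orbits_memD(1)[OF that(2,3)]
    by (auto simp: commuting_tuples_def)
  then show ?thesis
    by (auto simp: tuple_tree_def) blast
qed

lemma wf_digraph_tuple_tree: "wf_digraph (tuple_tree G)"
proof
  fix e assume e: "e \<in> arcs (tuple_tree G)"
  show "tail (tuple_tree G) e \<in> verts (tuple_tree G)"
    using e by (auto simp: tuple_tree_def)
  show "head (tuple_tree G) e \<in> verts (tuple_tree G)"
    using e by (auto simp: tuple_tree_def)
qed

text \<open>An arc provides an extension of some member of \<open>X\<close> only. Conjugating it by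
  an element that carries that member to \<open>hs\<close> gives an extension of \<open>hs\<close>
  itself.\<close>

lemma child_of_extends:
  assumes "(X, Y) \<in> arcs (tuple_tree G)" "hs \<in> X"
  obtains h where "hs @ [h] \<in> Y"
proof -
  have v: "X \<in> verts (tuple_tree G)" "Y \<in> verts (tuple_tree G)"
    using assms by (auto simp: arcs_tuple_tree_iff)
  obtain ks k where ks: "ks @ [k] \<in> Y" "ks \<in> X"
    using assms by (auto simp: arcs_tuple_tree_iff)
  obtain l where l: "l \<in> carrier G" "hs = conj_tuple G l ks"
    using verts_tuple_tree_memD(2)[OF v(1) ks(2)] assms(2) by (auto simp: orbit_def)
  have "conj_tuple G l (ks @ [k]) \<in> Y"
    using verts_tuple_tree_memD(2)[OF v(2) ks(1)] l(1) by (auto simp: orbit_def)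
  then show thesis
    using that l by (auto simp: conj_tuple_def)
qed

lemma reachable_tuple_tree_iff:
  assumes "X \<in> verts (tuple_tree G)" "gs \<in> X"
  shows "X \<rightarrow>\<^sup>*\<^bsub>tuple_tree G\<^esub> Y \<longleftrightarrow> Y \<in> verts (tuple_tree G) \<and> (\<exists>hs. gs @ hs \<in> Y)"
proof -
  interpret T: wf_digraph "tuple_tree G"
    by (rule wf_digraph_tuple_tree)
  \<comment> \<open>Arcs are pairs with the projections as tail and head, so each arc is its own
    pair of ends.\<close>
  have ends: "arcs_ends (tuple_tree G) = arcs (tuple_tree G)"
    by (simp add: tuple_tree_def)
  have extends: "\<exists>hs. gs @ hs \<in> Y" if "X \<rightarrow>\<^sup>*\<^bsub>tuple_tree G\<^esub> Y" for Y
    using that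
  proof (induction rule: T.reachable_induct)
    case base
    then show ?case
      using assms by (intro exI[of _ "[]"]) simp
  next
    case (step Y Z)
    then obtain hs where "gs @ hs \<in> Y"
      by blast
    \<comment> \<open>Extending this particular member of \<open>Y\<close> is what preserves the
      prefix \<open>gs\<close>.\<close>
    then obtain h where "(gs @ hs) @ [h] \<in> Z"
      using child_of_extends step ends by metis
    then show ?case
      by auto
  qed
  have reach: "X \<rightarrow>\<^sup>*\<^bsub>tuple_tree G\<^esub> Y" if "Y \<in> verts (tuple_tree G)" "gs @ hs \<in> Y" for hs Y
    using that
  proof (induction hs arbitrary: Y rule: rev_induct)
    case Nil
    \<comment> \<open>Both vertices contain \<open>gs\<close>, hence both are its orbit.\<close>
    then have "Y = X"
      using assms verts_tuple_tree_memD(2) by (metis append_Nil2)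
    then show ?case
      using assms by simp
  next
    case (snoc h hs)
    \<comment> \<open>The parent of \<open>Y\<close>: the orbit of the tuple with its last entry
      dropped.\<close>
    define Z where "Z = orbit G (conj_tuple G) (gs @ hs)"
    have comm: "gs @ hs \<in> commuting_tuples G (length (gs @ hs))"
      using verts_tuple_tree_memD(1)[OF snoc.prems] commuting_tuples_appendD1[of "gs @ hs" "[h]"]
      by simp
    then have Z: "Z \<in> verts (tuple_tree G)" "gs @ hs \<in> Z"
      unfolding Z_def by (auto intro: orbit_in_verts_tuple_tree in_orbit_self_commuting)
    then have "(Z, Y) \<in> arcs (tuple_tree G)"
      using snoc.prems by (auto simp: arcs_tuple_tree_iff intro!: exI[of _ "gs @ hs"])
    then show ?case
      using snoc.IH[OF Z] T.reachable_adj_trans ends by metis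
  qed
  show ?thesis
    using extends reach T.reachable_in_verts by blast
qed

section \<open>Centralizers of tuples\<close>

lemma conj_eq_self_iff:
  assumes "k \<in> carrier G" "g \<in> carrier G"
  shows "k \<otimes> g \<otimes> inv k = g \<longleftrightarrow> k \<otimes> g = g \<otimes> k"
  using assms by (metis inv_solve_right m_closed)

text \<open>This identifies the centralizer with the stabilizer of \<open>gs\<close> under
  simultaneous conjugation, the form used for the subgroup laws and for comparing orbits.\<close>

lemma tuple_centralizer_iff:
  assumes "set gs \<subseteq> carrier G"
  shows "k \<in> tuple_centralizer G gs \<longleftrightarrow> k \<in> carrier G \<and> conj_tuple G k gs = gs"
proof -
  have "conj_tuple G k gs = gs \<longleftrightarrow> (\<forall>g\<in>set gs. k \<otimes> g \<otimes> inv k = g)"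
    by (simp add: conj_tuple_def map_idI list_eq_iff_nth_eq all_set_conv_all_nth)
  moreover have "(\<forall>g\<in>set gs. k \<otimes> g \<otimes> inv k = g) \<longleftrightarrow> (\<forall>g\<in>set gs. k \<otimes> g = g \<otimes> k)"
    if "k \<in> carrier G"
    using assms that by (intro ball_cong conj_eq_self_iff) auto
  ultimately show ?thesis
    by (auto simp: tuple_centralizer_def centralizer_def)
qed

lemma subgroup_tuple_centralizer:
  assumes "set gs \<subseteq> carrier G"
  shows "subgroup (tuple_centralizer G gs) G"
proof (rule subgroupI)
  show "tuple_centralizer G gs \<noteq> {}"
    using assms tuple_centralizer_iff[of gs \<one>] conj_tuple_one by auto
  show "inv k \<in> tuple_centralizer G gs" if "k \<in> tuple_centralizer G gs" for k
  proof -
    have k: "k \<in> carrier G" "conj_tuple G k gs = gs"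
      using that assms by (auto simp: tuple_centralizer_iff)
    then have "conj_tuple G (inv k) gs = conj_tuple G (inv k) (conj_tuple G k gs)"
      by simp
    also have "\<dots> = gs"
      using assms k(1) by (simp add: conj_tuple_conj_tuple conj_tuple_one)
    finally show ?thesis
      using assms k by (simp add: tuple_centralizer_iff)
  qed
  show "k \<otimes> l \<in> tuple_centralizer G gs"
    if "k \<in> tuple_centralizer G gs" "l \<in> tuple_centralizer G gs" for k l
    using that assms
    by (simp add: tuple_centralizer_iff flip: conj_tuple_conj_tuple)
qed (auto simp: tuple_centralizer_def)

text \<open>Inverses are defined relative to the carrier, so shrinking it could change conjugation;
  for \<open>k\<close> in a subgroup the two inverses agree.\<close>

lemma conj_tuple_subgroup:
  "subgroup H G \<Longrightarrow> k \<in> H \<Longrightarrow> conj_tuple (G\<lparr>carrier := H\<rparr>) k hs = conj_tuple G k hs"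
  by (simp add: conj_tuple_def)

text \<open>Commutation within \<open>gs @ hs\<close> splits into three kinds of pairs: those inside
  \<open>gs\<close> are given, those inside \<open>hs\<close> appear on both sides, and the mixed
  ones say that the entries of \<open>hs\<close> centralize \<open>gs\<close>.\<close>

lemma commuting_tuples_centralizer_iff:
  assumes "gs \<in> commuting_tuples G n"
  shows "hs \<in> commuting_tuples (G\<lparr>carrier := tuple_centralizer G gs\<rparr>) m \<longleftrightarrow>
         gs @ hs \<in> commuting_tuples G (n + m)"
  using assms
  by (auto simp: commuting_tuples_def tuple_centralizer_def centralizer_def subset_iff)

lemma extensions_in_orbit:
  assumes "set gs \<subseteq> carrier G"
  shows "{hs'. gs @ hs' \<in> orbit G (conj_tuple G) (gs @ hs)} =
         orbit (G\<lparr>carrier := tuple_centralizer G gs\<rparr>)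
           (conj_tuple (G\<lparr>carrier := tuple_centralizer G gs\<rparr>)) hs"
proof -
  \<comment> \<open>Conjugation preserves length, so the equation of lists splits at the end of
    \<open>gs\<close>.\<close>
  have "gs @ hs' = conj_tuple G k (gs @ hs) \<longleftrightarrow> conj_tuple G k gs = gs \<and> hs' = conj_tuple G k hs"
    for k hs'
    by auto
  then have "{hs'. gs @ hs' \<in> orbit G (conj_tuple G) (gs @ hs)} =
      {conj_tuple G k hs |k. k \<in> tuple_centralizer G gs}"
    unfolding orbit_def tuple_centralizer_iff[OF assms] by blast
  also have "\<dots> = orbit (G\<lparr>carrier := tuple_centralizer G gs\<rparr>)
      (conj_tuple (G\<lparr>carrier := tuple_centralizer G gs\<rparr>)) hs"
    unfolding orbit_def
    by (intro Collect_cong ex_cong1)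
      (auto simp: conj_tuple_subgroup[OF subgroup_tuple_centralizer[OF assms]])
  finally show ?thesis .
qed

end

section \<open>The isomorphism\<close>

text \<open>When arcs are pairs of vertices, a vertex bijection that preserves and reflects
  adjacency determines the arc map.\<close>

lemma rooted_digraph_iso_by_verts:
  assumes "wf_digraph T" "tail T = fst" "head T = snd" "tail T' = fst" "head T' = snd"
    and "arcs T' \<subseteq> verts T' \<times> verts T'"
    and "bij_betw f (verts T) (verts T')" "f r = r'"
    and "\<And>u v. u \<in> verts T \<Longrightarrow> v \<in> verts T \<Longrightarrow> (u, v) \<in> arcs T \<longleftrightarrow> (f u, f v) \<in> arcs T'"
  shows "rooted_digraph_iso (T :: ('v, 'v \<times> 'v) pre_digraph) r (T' :: ('w, 'w \<times> 'w) pre_digraph) r'"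
proof -
  \<comment> \<open>\<open>app_iso\<close> takes its tail and head functions from
    \<open>hom\<close>, so these must be the projections for the final equality of records to
    hold.\<close>
  define hom where "hom = \<lparr>iso_verts = f, iso_arcs = map_prod f f,
     iso_head = (snd :: 'w \<times> 'w \<Rightarrow> 'w), iso_tail = (fst :: 'w \<times> 'w \<Rightarrow> 'w)\<rparr>"
  have arcs: "arcs T \<subseteq> verts T \<times> verts T"
    using wf_digraph.tail_in_verts[OF assms(1)] wf_digraph.head_in_verts[OF assms(1)] assms(2,3)
    by fastforce
  have inj: "inj_on f (verts T)" and img: "f ` verts T = verts T'"
    using assms(7) by (auto simp: bij_betw_def)
  have "inj_on (map_prod f f) (arcs T)"
    using map_prod_inj_on[OF inj inj] arcs by (rule inj_on_subset)
  then have iso: "pre_digraph.digraph_isomorphism T hom"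
    using assms(1-3) inj by (auto simp: pre_digraph.digraph_isomorphism_def hom_def)
  \<comment> \<open>Ends of arcs of \<open>T'\<close> are vertices, hence values of
    \<open>f\<close>; reflection of adjacency then gives a preimage arc.\<close>
  have "arcs T' \<subseteq> map_prod f f ` arcs T"
  proof
    fix e assume e: "e \<in> arcs T'"
    then obtain u v where "e = (f u, f v)" "u \<in> verts T" "v \<in> verts T"
      using assms(6) img by blast
    then show "e \<in> map_prod f f ` arcs T"
      using e assms(9) by (intro image_eqI[of _ _ "(u, v)"]) auto
  qed
  moreover have "map_prod f f ` arcs T \<subseteq> arcs T'"
    using arcs assms(9) by auto
  ultimately have "T' = app_iso hom T"
    using img assms(4,5) by (intro pre_digraph.equality) (auto simp: hom_def)
  then show ?thesis
    using iso assms(8) unfolding rooted_digraph_iso_def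
    by (intro exI[of _ hom]) (simp add: hom_def)
qed

theorem theorem4:
  fixes G :: "('a, 'b) monoid_scheme" and n :: nat
    and gs :: "'a list" and X :: "'a list set" and S :: "'a set"
  assumes "group G" and "finite (carrier G)"
    and "gs \<in> commuting_tuples G n"
    and "X \<in> tuple_orbits G n" and "gs \<in> X"
    and "S = tuple_centralizer G gs"
  shows "rooted_digraph_iso (descendant_tree (tuple_tree G) X) X
           (tuple_tree (G\<lparr>carrier := S\<rparr>)) (tuple_tree_root (G\<lparr>carrier := S\<rparr>))"
proof -
  interpret G: group G by fact
  define K where "K = G\<lparr>carrier := S\<rparr>"
  define D where "D = {Y. X \<rightarrow>\<^sup>*\<^bsub>tuple_tree G\<^esub> Y}"
  define F where "F Y = {hs. gs @ hs \<in> Y}" for Y :: "'a list set"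
  have gs: "set gs \<subseteq> carrier G"
    using assms(3) by (simp add: commuting_tuples_def)
  \<comment> \<open>With \<open>K\<close> a group, the lemmas on tuple trees apply on both sides of
    the isomorphism.\<close>
  interpret K: group K
    unfolding K_def assms(6)
    using G.subgroup_tuple_centralizer[OF gs] assms(1) by (rule subgroup.subgroup_is_group)
  have XV: "X \<in> verts (tuple_tree G)"
    using assms(4) by (auto simp: tuple_tree_def)
  have D_iff: "Y \<in> D \<longleftrightarrow> Y \<in> verts (tuple_tree G) \<and> (\<exists>hs. gs @ hs \<in> Y)" for Y
    unfolding D_def using G.reachable_tuple_tree_iff[OF XV assms(5)] by simp
  have F_orbit: "F (orbit G (conj_tuple G) (gs @ hs)) = orbit K (conj_tuple K) hs" for hs
    unfolding F_def K_def assms(6) using G.extensions_in_orbit[OF gs] .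
  have comm: "hs \<in> commuting_tuples K m \<longleftrightarrow> gs @ hs \<in> commuting_tuples G (n + m)" for hs m
    unfolding K_def assms(6) using G.commuting_tuples_centralizer_iff[OF assms(3)] .
  have n: "length gs = n"
    using assms(3) by (rule commuting_tuples_length)
  have F_verts: "F Y \<in> verts (tuple_tree K)" if Y: "Y \<in> D" for Y
  proof -
    obtain hs where hs: "Y \<in> verts (tuple_tree G)" "gs @ hs \<in> Y"
      using Y by (auto simp: D_iff)
    have "hs \<in> commuting_tuples K (length hs)"
      using G.verts_tuple_tree_memD(1)[OF hs] comm n by simp
    then show ?thesis
      using G.verts_tuple_tree_memD(2)[OF hs] F_orbit K.orbit_in_verts_tuple_tree by metis
  qed
  have "inj_on F D"
  proof (rule inj_onI)
    fix Y Z assume YZ: "Y \<in> D" "Z \<in> D" "F Y = F Z"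
    then obtain hs where "gs @ hs \<in> Y"
      by (auto simp: D_iff)
    \<comment> \<open>\<open>F Y\<close> is nonempty because \<open>Y\<close> is a descendant, so
      \<open>F Y = F Z\<close> yields a common member of \<open>Y\<close> and \<open>Z\<close>,
      which determines both orbits.\<close>
    moreover from this have "gs @ hs \<in> Z"
      using YZ(3) by (auto simp: F_def)
    ultimately show "Y = Z"
      using YZ(1,2) G.verts_tuple_tree_memD(2)[of Y "gs @ hs"]
        G.verts_tuple_tree_memD(2)[of Z "gs @ hs"] by (simp add: D_iff)
  qed
  moreover have "verts (tuple_tree K) \<subseteq> F ` D"
  proof
    fix Z assume Z: "Z \<in> verts (tuple_tree K)"
    then obtain hs where hs: "hs \<in> Z" "hs \<in> commuting_tuples K (length hs)"
      by (rule K.verts_tuple_treeE)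
    \<comment> \<open>The preimage of \<open>Z\<close> comes from prefixing \<open>gs\<close> to a
      representative.\<close>
    let ?Y = "orbit G (conj_tuple G) (gs @ hs)"
    have "gs @ hs \<in> commuting_tuples G (n + length hs)"
      using hs comm by simp
    then have "?Y \<in> D"
      unfolding D_iff using G.orbit_in_verts_tuple_tree G.in_orbit_self_commuting by blast
    moreover have "F ?Y = Z"
      using F_orbit K.verts_tuple_tree_memD(2)[OF Z hs(1)] by simp
    ultimately show "Z \<in> F ` D"
      by blast
  qed
  ultimately have bij: "bij_betw F D (verts (tuple_tree K))"
    using F_verts by (auto simp: bij_betw_def)
  have arcs: "(Y, Z) \<in> arcs (tuple_tree G) \<longleftrightarrow> (F Y, F Z) \<in> arcs (tuple_tree K)"
    if YZ: "Y \<in> D" "Z \<in> D" for Y Z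
  proof
    assume YZ_arc: "(Y, Z) \<in> arcs (tuple_tree G)"
    obtain hs where hs: "gs @ hs \<in> Y"
      using YZ by (auto simp: D_iff)
    \<comment> \<open>The new entry is appended to a member starting with \<open>gs\<close>, so
      removing \<open>gs\<close> leaves a parent and child pair in the tree of
      \<open>K\<close>.\<close>
    with YZ_arc obtain h where "(gs @ hs) @ [h] \<in> Z"
      by (rule G.child_of_extends)
    then have "hs \<in> F Y" "hs @ [h] \<in> F Z"
      using hs by (auto simp: F_def)
    then show "(F Y, F Z) \<in> arcs (tuple_tree K)"
      using F_verts YZ by (auto simp: K.arcs_tuple_tree_iff)
  next
    assume "(F Y, F Z) \<in> arcs (tuple_tree K)"
    then obtain hs h where "hs @ [h] \<in> F Z" "hs \<in> F Y"
      by (auto simp: K.arcs_tuple_tree_iff)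
    then have "(gs @ hs) @ [h] \<in> Z" "gs @ hs \<in> Y"
      by (auto simp: F_def)
    then show "(Y, Z) \<in> arcs (tuple_tree G)"
      using YZ unfolding D_iff G.arcs_tuple_tree_iff by blast
  qed
  have root: "F X = tuple_tree_root K"
  proof -
    \<comment> \<open>\<open>X\<close> is the orbit of \<open>gs @ []\<close>, so level
      \<open>n\<close> is sent to level 0.\<close>
    have "F X = orbit K (conj_tuple K) []"
      using F_orbit[of "[]"] G.verts_tuple_tree_memD(2)[OF XV assms(5)] by simp
    also have "\<dots> = {[]}"
      using K.one_closed by (auto simp: orbit_def conj_tuple_def)
    finally show ?thesis
      using tuple_tree_root_eq[OF K.is_group] by simp
  qed
  have T: "descendant_tree (tuple_tree G) X = tuple_tree G \<restriction> D"
    by (simp add: descendant_tree_def D_def)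
  have "rooted_digraph_iso (tuple_tree G \<restriction> D) X (tuple_tree K) (tuple_tree_root K)"
  proof (rule rooted_digraph_iso_by_verts[where f = F])
    show "wf_digraph (tuple_tree G \<restriction> D)"
      using G.wf_digraph_tuple_tree by (rule wf_digraph.wellformed_induce_subgraph)
    show "tail (tuple_tree G \<restriction> D) = fst" "head (tuple_tree G \<restriction> D) = snd"
      "tail (tuple_tree K) = fst" "head (tuple_tree K) = snd"
      by (simp_all add: tuple_tree_def)
    show "arcs (tuple_tree K) \<subseteq> verts (tuple_tree K) \<times> verts (tuple_tree K)"
      using K.arcs_tuple_tree_iff by auto
    show "bij_betw F (verts (tuple_tree G \<restriction> D)) (verts (tuple_tree K))"
      using bij by simp
    show "F X = tuple_tree_root K"
      by (rule root)
    show "(Y, Z) \<in> arcs (tuple_tree G \<restriction> D) \<longleftrightarrow> (F Y, F Z) \<in> arcs (tuple_tree K)"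
      if "Y \<in> verts (tuple_tree G \<restriction> D)" "Z \<in> verts (tuple_tree G \<restriction> D)" for Y Z
      using arcs that by (auto simp: tuple_tree_def)
  qed
  then show ?thesis
    unfolding T K_def .
qed

end
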